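(* Let $\mathbf{x}^{*}$ be an optimal solution of the convexified optimal energy flow problem, let $g_l^{*}$ ($l\in\mathcal{L}_g$) be the gas flows through the passive pipelines in $\mathbf{x}^{*}$, and consider the recovery problem associated with $(g_l^{*})_{l}$. If this recovery problem is feasible and its (optimal) objective value is equal to zero, then the original optimal energy flow problem and the convexified optimal energy flow problem have the same optimum (optimal objective value).
   Context: **Setting.** An integrated electricity-gas system is divided into $N\ge 2$ blocks: power blocks $r=1,\dots,N-1$ and one gas block. All sets are finite. Capital-letter quantities, $\mathrm{x}_l$, $\alpha_c$, $\chi_g$, $\mathrm{W}_l>0$ and all cost coefficients are given real constants. **Power block $r$.** Sets: coal-fired generators $\mathcal{G}_p^r$, gas-fired generators $\mathcal{G}_g^r$, lines $\mathcal{L}_p^r$, actual power nodes $\mathcal{N}_p^r$, virtual power nodes $\mathcal{N}_v^r$ (each is a replica of an actual node of another power block), loads $\mathcal{D}_p^r$. Variables: coal-fired outputs $p_g$, gas-fired outputs $g_g$, phase angles $\theta_i$ (of actual and virtual nodes), line flows $p_l$. Constraints: - (P1) $\mathrm{P}_g^{\min}\le p_g\le \mathrm{P}_g^{\max}$ for $g\in\mathcal{G}_p^r$; $\mathrm{G}_g^{\min}\le g_g\le \mathrm{G}_g^{\max}$ for $g\in\mathcal{G}_g^r$; $\theta_i^{\min}\le\theta_i\le\theta_i^{\max}$ for $i\in\mathcal{N}_p^r$; $-\mathrm{P}_l\le p_l\le \mathrm{P}_l$ for $l\in\mathcal{L}_p^r$. - (P2) $\mathrm{x}_l p_l=\theta_{i(l)}-\theta_{j(l)}$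 for $l\in\mathcal{L}_p^r$, where $i(l),j(l)$ are the end nodes of $l$ in block $r$ (one of them may be virtual). - (P3) at each actual node $i\in\mathcal{N}_p^r$: (sum of $p_g$ of coal-fired generators at $i$) + (sum of $g_g$ of gas-fired generators at $i$) + (sum of $p_l$ over lines into $i$) − (sum of $p_l$ over lines out of $i$) = (sum of loads $\mathrm{P}_d$ at $i$). **Gas block.** Sets: gas wells $\mathcal{W}$, gas nodes $\mathcal{N}_g$, passive pipelines $\mathcal{L}_g$, compressors (active pipelines) $\mathcal{C}_g$, loads $\mathcal{D}_g$, virtual gas-fired generators $\mathcal{G}_v$ (each a replica of an actual gas-fired generator in a power block). Each passive pipeline $l$ joins nodes $i(l)$ and $j(l)$ (reference direction $i(l)\to j(l)$); each compressor $c$ has inflow node $i(c)$ and outflow node $j(c)$. Variables: well outputs $g_w$, passive pipeline flows $g_l$, compressor flows $g_c$, squared node pressures $\pi_i$, virtual generator outputs $g_{g'}$. Constraints: - (G1) $\mathrm{G}_w^{\min}\le g_w\le \mathrm{G}_w^{\max}$ for $w\in\mathcal{W}$; $0\le g_c\le \mathrm{G}_c$ for $c\in\mathcal{C}_g$. - (G2) $\mathrm{G}_i^{\min}\le\pi_i\le \mathrm{G}_i^{\max}$ for $i\in\mathcal{N}_g$. - (G3) (Weymouth equation) $g_l^2\,\mathrm{sgn}(g_l)=\mathrm{W}_l(\pi_{i(l)}-\pi_{j(l)})$ for $l\in\mathcal{L}_g$, where $\mathrm{sgn}(t)=1$ if $t\ge0$ and $-1$ if $t<0$. (If the flow direction of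 $l$ is fixed, it is additionally required that $\pi_{i(l)}\ge\pi_{j(l)}$.) - (G4) $\pi_{j(c)}\le\alpha_c\pi_{i(c)}$ for $c\in\mathcal{C}_g$. - (G5) at each $i\in\mathcal{N}_g$: (sum of $g_w$ of wells at $i$) + (sum of passive pipeline flows into $i$) − (sum of passive pipeline flows out of $i$) + (sum of compressor flows into $i$) − (sum of compressor flows out of $i$) = (sum of loads $\mathrm{G}_d$ at $i$) + (sum of $\chi_g\, g_{g'}$ over virtual gas-fired generators at $i$). **Coupling constraints.** $\theta_i=\theta_{i'}$ for every virtual power node $i'$ and the actual node $i$ it replicates; $g_g=g_{g'}$ for every virtual gas-fired generator $g'$ and the actual gas-fired generator $g$ it replicates. **Original problem.** Minimize $\sum_{r=1}^{N-1}\sum_{g\in\mathcal{G}_p^r}\mathrm{C}_p(p_g)+\sum_{w\in\mathcal{W}}\mathrm{C}_w g_w$, where $\mathrm{C}_p(p)=\mathrm{c}_1p^2+\mathrm{c}_2p+\mathrm{c}_3$ with $\mathrm{c}_1>0$ (coefficients may depend on the generator), subject to (P1)–(P3) for all $r$, (G1)–(G5), and the coupling constraints. It is assumed feasible. **Convexified problem.** The same problem with (G3) replaced, for each $l\in\mathcal{L}_g$, by its extended convex hull (ECH). Let $\mathcal{Y}_l$ be the set of pairs $(\pi_{i(l)}-\pi_{j(l)},g_l)$ satisfying (G3) with $\pi_{i(l)},\pi_{j(l)}$ within the limits (G2). The ECH is a convex set containing the convex hull of $\mathcal{Y}_l$. It has one of two forms: - form A (general case): $\mathrm{G}_l^{\min}\le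 g_l\le \mathrm{G}_l^{\max}$, $\ \mathrm{a}_l^{\mathrm L}(\pi_{i(l)}-\pi_{j(l)})+\mathrm{b}_l^{\mathrm L}\le g_l\le \mathrm{a}_l^{\mathrm U}(\pi_{i(l)}-\pi_{j(l)})+\mathrm{b}_l^{\mathrm U}$, with constants such that the region contains $\mathcal{Y}_l$; - form B (when $\mathrm{G}_{i(l)}^{\min}\ge \mathrm{G}_{j(l)}^{\max}$, or the flow direction of $l$ is fixed): $\mathrm{a}_l^{\mathrm U}(\pi_{i(l)}-\pi_{j(l)})+\mathrm{b}_l^{\mathrm U}\le g_l$ and $g_l^2\le \mathrm{W}_l(\pi_{i(l)}-\pi_{j(l)})$, where the linear inequality is given by the chord joining the end points of the curve $\mathcal{Y}_l$, so that the ECH equals the convex hull of $\mathcal{Y}_l$. **Recovery problem associated with $(g_l^* )_{l\in\mathcal{L}_g}$.** In the variables $\boldsymbol\pi=(\pi_i)$, $\boldsymbol\delta^+=(\delta_i^+)$, $\boldsymbol\delta^-=(\delta_i^-)$, $i\in\mathcal{N}_g$: $$\min\ \sum_{i}\delta_i^+ +\sum_i\delta_i^-$$ subject to $(g_l^* )^2\,\mathrm{sgn}(g_l^* )=\mathrm{W}_l(\pi_{i(l)}-\pi_{j(l)})$ for $l\in\mathcal{L}_g$; $(1-\delta_i^-)\mathrm{G}_i^{\min}\le\pi_i\le(1+\delta_i^+)\mathrm{G}_i^{\max}$ for $i\in\mathcal{N}_g$; $\pi_{j(c)}\le\alpha_c\pi_{i(c)}$ for $c\in\mathcal{C}_g$;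 $\delta_i^+,\delta_i^-\ge0$ for $i\in\mathcal{N}_g$. *)

theory Defs
  imports "HOL-Analysis.Analysis"
begin

text \<open>Components of all kinds are labelled by elements of one type \<open>'a\<close>. Sets and variables of the
  power blocks are moreover indexed by the block number, so labels may be reused in different
  blocks without identifying the components.\<close>

record 'a power_block =
  coal_gens  :: "'a set"
  gas_gens   :: "'a set"
  lines      :: "'a set"
  act_nodes  :: "'a set"
  virt_nodes :: "'a set"
  ploads     :: "'a set"
  coal_node  :: "'a \<Rightarrow> 'a"
  gas_node   :: "'a \<Rightarrow> 'a"
  pload_node :: "'a \<Rightarrow> 'a"
  line_from  :: "'a \<Rightarrow> 'a"
  line_to    :: "'a \<Rightarrow> 'a"
  node_orig  :: "'a \<Rightarrow> nat \<times> 'a"  \<comment> \<open>block and node which a virtual node replicates\<close>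
  coal_min   :: "'a \<Rightarrow> real"
  coal_max   :: "'a \<Rightarrow> real"
  gas_min    :: "'a \<Rightarrow> real"
  gas_max    :: "'a \<Rightarrow> real"
  angle_min  :: "'a \<Rightarrow> real"
  angle_max  :: "'a \<Rightarrow> real"
  line_cap   :: "'a \<Rightarrow> real"
  reactance  :: "'a \<Rightarrow> real"
  pdemand    :: "'a \<Rightarrow> real"
  chi        :: "'a \<Rightarrow> real"  \<comment> \<open>conversion factor of an actual gas-fired generator\<close>
  cost1      :: "'a \<Rightarrow> real"
  cost2      :: "'a \<Rightarrow> real"
  cost3      :: "'a \<Rightarrow> real"

record 'a gas_block =
  wells      :: "'a set"
  gnodes     :: "'a set"
  pipes      :: "'a set"
  compressors :: "'a set"
  gloads     :: "'a set"
  virt_gens  :: "'a set"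
  well_node  :: "'a \<Rightarrow> 'a"
  pipe_from  :: "'a \<Rightarrow> 'a"
  pipe_to    :: "'a \<Rightarrow> 'a"
  comp_from  :: "'a \<Rightarrow> 'a"
  comp_to    :: "'a \<Rightarrow> 'a"
  gload_node :: "'a \<Rightarrow> 'a"
  virt_node  :: "'a \<Rightarrow> 'a"  \<comment> \<open>gas node to which a virtual generator is attached\<close>
  gen_orig   :: "'a \<Rightarrow> nat \<times> 'a"  \<comment> \<open>power block and gas-fired generator which it replicates\<close>
  fixed_pipes :: "'a set"  \<comment> \<open>passive pipelines whose flow direction is fixed\<close>
  well_min   :: "'a \<Rightarrow> real"
  well_max   :: "'a \<Rightarrow> real"
  comp_cap   :: "'a \<Rightarrow> real"
  press_min  :: "'a \<Rightarrow> real"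
  press_max  :: "'a \<Rightarrow> real"
  weym       :: "'a \<Rightarrow> real"
  ratio      :: "'a \<Rightarrow> real"
  gdemand    :: "'a \<Rightarrow> real"
  well_cost  :: "'a \<Rightarrow> real"

record 'a energy_system =
  nblocks :: nat  \<comment> \<open>number of all blocks, the gas block included\<close>
  pblock  :: "nat \<Rightarrow> 'a power_block"
  gblock  :: "'a gas_block"

definition pblocks :: "'a energy_system \<Rightarrow> nat set" where
  "pblocks S = {1..nblocks S - 1}"

definition wf_power_block :: "'a energy_system \<Rightarrow> nat \<Rightarrow> bool" where
  "wf_power_block S r \<longleftrightarrow> (let B = pblock S r in
     finite (coal_gens B) \<and> finite (gas_gens B) \<and> finite (lines B) \<and>
     finite (act_nodes B) \<and> finite (virt_nodes B) \<and> finite (ploads B) \<and>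
     act_nodes B \<inter> virt_nodes B = {} \<and>
     coal_node B ` coal_gens B \<subseteq> act_nodes B \<and>
     gas_node B ` gas_gens B \<subseteq> act_nodes B \<and>
     pload_node B ` ploads B \<subseteq> act_nodes B \<and>
     (\<forall>l\<in>lines B. line_from B l \<in> act_nodes B \<union> virt_nodes B \<and>
        line_to B l \<in> act_nodes B \<union> virt_nodes B \<and>
        (line_from B l \<in> act_nodes B \<or> line_to B l \<in> act_nodes B)) \<and>
     (\<forall>i'\<in>virt_nodes B. case node_orig B i' of (s, i) \<Rightarrow>
        s \<in> pblocks S \<and> s \<noteq> r \<and> i \<in> act_nodes (pblock S s)) \<and>
     (\<forall>g\<in>coal_gens B. cost1 B g > 0))"

definition wf_gas_block :: "'a energy_system \<Rightarrow> bool" where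
  "wf_gas_block S \<longleftrightarrow> (let G = gblock S in
     finite (wells G) \<and> finite (gnodes G) \<and> finite (pipes G) \<and>
     finite (compressors G) \<and> finite (gloads G) \<and> finite (virt_gens G) \<and>
     fixed_pipes G \<subseteq> pipes G \<and>
     well_node G ` wells G \<subseteq> gnodes G \<and>
     pipe_from G ` pipes G \<subseteq> gnodes G \<and> pipe_to G ` pipes G \<subseteq> gnodes G \<and>
     comp_from G ` compressors G \<subseteq> gnodes G \<and> comp_to G ` compressors G \<subseteq> gnodes G \<and>
     gload_node G ` gloads G \<subseteq> gnodes G \<and> virt_node G ` virt_gens G \<subseteq> gnodes G \<and>
     (\<forall>g'\<in>virt_gens G. case gen_orig G g' of (s, g) \<Rightarrow>
        s \<in> pblocks S \<and> g \<in> gas_gens (pblock S s)) \<and>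
     (\<forall>l\<in>pipes G. weym G l > 0))"

definition wf_system :: "'a energy_system \<Rightarrow> bool" where
  "wf_system S \<longleftrightarrow> nblocks S \<ge> 2 \<and> (\<forall>r\<in>pblocks S. wf_power_block S r) \<and> wf_gas_block S"

text \<open>Decision variables. Values at labels outside the respective index sets are irrelevant: no
  constraint and no objective refers to them.\<close>

record 'a flow_point =
  coal_out  :: "nat \<Rightarrow> 'a \<Rightarrow> real"
  gas_out   :: "nat \<Rightarrow> 'a \<Rightarrow> real"
  angle     :: "nat \<Rightarrow> 'a \<Rightarrow> real"
  line_flow :: "nat \<Rightarrow> 'a \<Rightarrow> real"
  well_out  :: "'a \<Rightarrow> real"
  pipe_flow :: "'a \<Rightarrow> real"
  comp_flow :: "'a \<Rightarrow> real"
  pressure  :: "'a \<Rightarrow> real"  \<comment> \<open>squared node pressures\<close>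
  virt_out  :: "'a \<Rightarrow> real"

definition power_limits :: "'a energy_system \<Rightarrow> nat \<Rightarrow> 'a flow_point \<Rightarrow> bool" where
  "power_limits S r x \<longleftrightarrow> (let B = pblock S r in
     (\<forall>g\<in>coal_gens B. coal_min B g \<le> coal_out x r g \<and> coal_out x r g \<le> coal_max B g) \<and>
     (\<forall>g\<in>gas_gens B. gas_min B g \<le> gas_out x r g \<and> gas_out x r g \<le> gas_max B g) \<and>
     (\<forall>i\<in>act_nodes B. angle_min B i \<le> angle x r i \<and> angle x r i \<le> angle_max B i) \<and>
     (\<forall>l\<in>lines B. - line_cap B l \<le> line_flow x r l \<and> line_flow x r l \<le> line_cap B l))"

definition power_flow_eqs :: "'a energy_system \<Rightarrow> nat \<Rightarrow> 'a flow_point \<Rightarrow> bool" where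
  "power_flow_eqs S r x \<longleftrightarrow> (let B = pblock S r in
     \<forall>l\<in>lines B. reactance B l * line_flow x r l
       = angle x r (line_from B l) - angle x r (line_to B l))"

definition power_balance :: "'a energy_system \<Rightarrow> nat \<Rightarrow> 'a flow_point \<Rightarrow> bool" where
  "power_balance S r x \<longleftrightarrow> (let B = pblock S r in
     \<forall>i\<in>act_nodes B.
       (\<Sum>g | g \<in> coal_gens B \<and> coal_node B g = i. coal_out x r g)
       + (\<Sum>g | g \<in> gas_gens B \<and> gas_node B g = i. gas_out x r g)
       + (\<Sum>l | l \<in> lines B \<and> line_to B l = i. line_flow x r l)
       - (\<Sum>l | l \<in> lines B \<and> line_from B l = i. line_flow x r l)
       = (\<Sum>d | d \<in> ploads B \<and> pload_node B d = i. pdemand B d))"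

definition gas_limits :: "'a gas_block \<Rightarrow> 'a flow_point \<Rightarrow> bool" where
  "gas_limits G x \<longleftrightarrow>
     (\<forall>w\<in>wells G. well_min G w \<le> well_out x w \<and> well_out x w \<le> well_max G w) \<and>
     (\<forall>c\<in>compressors G. 0 \<le> comp_flow x c \<and> comp_flow x c \<le> comp_cap G c)"

definition pressure_limits :: "'a gas_block \<Rightarrow> ('a \<Rightarrow> real) \<Rightarrow> 'a set \<Rightarrow> bool" where
  "pressure_limits G \<pi> I \<longleftrightarrow> (\<forall>i\<in>I. press_min G i \<le> \<pi> i \<and> \<pi> i \<le> press_max G i)"

text \<open>Unlike the library function \<open>sgn\<close>, this takes the value 1 at 0.\<close>

definition flow_sgn :: "real \<Rightarrow> real" where
  "flow_sgn t = (if t \<ge> 0 then 1 else - 1)"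

definition weymouth_eq :: "'a gas_block \<Rightarrow> 'a \<Rightarrow> ('a \<Rightarrow> real) \<Rightarrow> real \<Rightarrow> bool" where
  "weymouth_eq G l \<pi> q \<longleftrightarrow>
     q\<^sup>2 * flow_sgn q = weym G l * (\<pi> (pipe_from G l) - \<pi> (pipe_to G l))"

definition weymouth :: "'a gas_block \<Rightarrow> 'a \<Rightarrow> ('a \<Rightarrow> real) \<Rightarrow> real \<Rightarrow> bool" where
  "weymouth G l \<pi> q \<longleftrightarrow> weymouth_eq G l \<pi> q \<and>
     (l \<in> fixed_pipes G \<longrightarrow> \<pi> (pipe_from G l) \<ge> \<pi> (pipe_to G l))"

definition compression :: "'a gas_block \<Rightarrow> ('a \<Rightarrow> real) \<Rightarrow> bool" where
  "compression G \<pi> \<longleftrightarrow>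
     (\<forall>c\<in>compressors G. \<pi> (comp_to G c) \<le> ratio G c * \<pi> (comp_from G c))"

definition gas_balance :: "'a energy_system \<Rightarrow> 'a flow_point \<Rightarrow> bool" where
  "gas_balance S x \<longleftrightarrow> (let G = gblock S in
     \<forall>i\<in>gnodes G.
       (\<Sum>w | w \<in> wells G \<and> well_node G w = i. well_out x w)
       + (\<Sum>l | l \<in> pipes G \<and> pipe_to G l = i. pipe_flow x l)
       - (\<Sum>l | l \<in> pipes G \<and> pipe_from G l = i. pipe_flow x l)
       + (\<Sum>c | c \<in> compressors G \<and> comp_to G c = i. comp_flow x c)
       - (\<Sum>c | c \<in> compressors G \<and> comp_from G c = i. comp_flow x c)
       = (\<Sum>d | d \<in> gloads G \<and> gload_node G d = i. gdemand G d)
       + (\<Sum>g' | g' \<in> virt_gens G \<and> virt_node G g' = i.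
            (case gen_orig G g' of (s, g) \<Rightarrow> chi (pblock S s) g) * virt_out x g'))"

definition coupling :: "'a energy_system \<Rightarrow> 'a flow_point \<Rightarrow> bool" where
  "coupling S x \<longleftrightarrow>
     (\<forall>r\<in>pblocks S. \<forall>i'\<in>virt_nodes (pblock S r).
        case node_orig (pblock S r) i' of (s, i) \<Rightarrow> angle x s i = angle x r i') \<and>
     (\<forall>g'\<in>virt_gens (gblock S).
        case gen_orig (gblock S) g' of (s, g) \<Rightarrow> gas_out x s g = virt_out x g')"

text \<open>All constraints shared by the original and the convexified problem, that is, all except
  the Weymouth equation and its relaxation.\<close>

definition common_constraints :: "'a energy_system \<Rightarrow> 'a flow_point \<Rightarrow> bool" where
  "common_constraints S x \<longleftrightarrow>
     (\<forall>r\<in>pblocks S. power_limits S r x \<and> power_flow_eqs S r x \<and> power_balance S r x) \<and>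
     gas_limits (gblock S) x \<and>
     pressure_limits (gblock S) (pressure x) (gnodes (gblock S)) \<and>
     compression (gblock S) (pressure x) \<and>
     gas_balance S x \<and>
     coupling S x"

definition oef_cost :: "'a energy_system \<Rightarrow> 'a flow_point \<Rightarrow> real" where
  "oef_cost S x =
     (\<Sum>r\<in>pblocks S. \<Sum>g\<in>coal_gens (pblock S r).
        cost1 (pblock S r) g * (coal_out x r g)\<^sup>2
        + cost2 (pblock S r) g * coal_out x r g + cost3 (pblock S r) g)
     + (\<Sum>w\<in>wells (gblock S). well_cost (gblock S) w * well_out x w)"

definition original_feasible :: "'a energy_system \<Rightarrow> 'a flow_point set" where
  "original_feasible S = {x. common_constraints S x \<and>
     (\<forall>l\<in>pipes (gblock S). weymouth (gblock S) l (pressure x) (pipe_flow x l))}"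

definition weymouth_curve :: "'a gas_block \<Rightarrow> 'a \<Rightarrow> (real \<times> real) set" where
  "weymouth_curve G l = {(\<pi> (pipe_from G l) - \<pi> (pipe_to G l), q) | \<pi> q.
     weymouth G l \<pi> q \<and> pressure_limits G \<pi> {pipe_from G l, pipe_to G l}}"

definition curve_end_points :: "'a gas_block \<Rightarrow> 'a \<Rightarrow> (real \<times> real) set" where
  "curve_end_points G l = {y \<in> weymouth_curve G l.
     (\<forall>z\<in>weymouth_curve G l. fst y \<le> fst z) \<or> (\<forall>z\<in>weymouth_curve G l. fst z \<le> fst y)}"

record 'a ech_consts =
  flow_min :: "'a \<Rightarrow> real"
  flow_max :: "'a \<Rightarrow> real"
  slopeL   :: "'a \<Rightarrow> real"
  interL   :: "'a \<Rightarrow> real"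
  slopeU   :: "'a \<Rightarrow> real"
  interU   :: "'a \<Rightarrow> real"

definition one_sided :: "'a gas_block \<Rightarrow> 'a \<Rightarrow> bool" where
  "one_sided G l \<longleftrightarrow>
     press_min G (pipe_from G l) \<ge> press_max G (pipe_to G l) \<or> l \<in> fixed_pipes G"

definition ech :: "'a gas_block \<Rightarrow> 'a ech_consts \<Rightarrow> 'a \<Rightarrow> (real \<times> real) set" where
  "ech G E l = (if one_sided G l
     then {(d, q). slopeU E l * d + interU E l \<le> q \<and> q\<^sup>2 \<le> weym G l * d}
     else {(d, q). flow_min E l \<le> q \<and> q \<le> flow_max E l \<and>
             slopeL E l * d + interL E l \<le> q \<and> q \<le> slopeU E l * d + interU E l})"

text \<open>In the one-sided case the line passes through the end points of the curve; if these are
  distinct, this determines the line and makes the region equal to the convex hull of the curve.\<close>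

definition valid_ech :: "'a gas_block \<Rightarrow> 'a ech_consts \<Rightarrow> bool" where
  "valid_ech G E \<longleftrightarrow> (\<forall>l\<in>pipes G. if one_sided G l
     then (\<forall>(d, q)\<in>curve_end_points G l. q = slopeU E l * d + interU E l)
     else weymouth_curve G l \<subseteq> ech G E l)"

definition convexified_feasible ::
  "'a energy_system \<Rightarrow> 'a ech_consts \<Rightarrow> 'a flow_point set" where
  "convexified_feasible S E = {x. common_constraints S x \<and>
     (\<forall>l\<in>pipes (gblock S).
        (pressure x (pipe_from (gblock S) l) - pressure x (pipe_to (gblock S) l), pipe_flow x l)
          \<in> ech (gblock S) E l)}"

record 'a recovery_point =
  rec_pressure :: "'a \<Rightarrow> real"
  delta_plus   :: "'a \<Rightarrow> real"
  delta_minus  :: "'a \<Rightarrow> real"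

definition recovery_feasible ::
  "'a gas_block \<Rightarrow> ('a \<Rightarrow> real) \<Rightarrow> 'a recovery_point set" where
  "recovery_feasible G q = {y.
     (\<forall>l\<in>pipes G. weymouth_eq G l (rec_pressure y) (q l)) \<and>
     (\<forall>i\<in>gnodes G. (1 - delta_minus y i) * press_min G i \<le> rec_pressure y i \<and>
        rec_pressure y i \<le> (1 + delta_plus y i) * press_max G i) \<and>
     compression G (rec_pressure y) \<and>
     (\<forall>i\<in>gnodes G. delta_plus y i \<ge> 0 \<and> delta_minus y i \<ge> 0)}"

definition recovery_cost :: "'a gas_block \<Rightarrow> 'a recovery_point \<Rightarrow> real" where
  "recovery_cost G y = (\<Sum>i\<in>gnodes G. delta_plus y i) + (\<Sum>i\<in>gnodes G. delta_minus y i)"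

text \<open>Optimal value of the problem of minimizing \<open>f\<close> over \<open>F\<close>, extended-real valued so that
  infeasible and unbounded problems have the values \<open>\<infinity>\<close> and \<open>-\<infinity>\<close>.\<close>

definition optimal_value :: "'x set \<Rightarrow> ('x \<Rightarrow> real) \<Rightarrow> ereal" where
  "optimal_value F f = (INF x\<in>F. ereal (f x))"

end

theory Submission
  imports Defs
begin

text \<open>The convexified problem is a relaxation of the original one: a one-sided Weymouth curve is an
  arc of the concave graph \<open>q = sqrt (W d)\<close> and thus lies above its chord
  (\<open>chord_below_sqrt\<close>), while the two-sided region contains the curve by hypothesis. So
  the convexified optimum is a lower bound for the original one.

  Conversely, let \<open>x\<close> be an optimal solution of the convexified problem. The cost does not
  depend on the pressures, and neither do any constraints except the pressure limits, the
  compressor ratios and the Weymouth equations. It is therefore enough to replace the pressures in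
  \<open>x\<close> by others that satisfy these three groups of constraints for the pipeline flows of
  \<open>x\<close>. A recovery point with all slacks equal to zero supplies such pressures. The optimal
  value is an infimum, so a compactness argument is needed to see that the value zero is attained
  (\<open>recovery_value_zero_attained\<close>).

  One condition is not part of the recovery problem: on a pipeline with fixed flow direction, the
  pressure must not increase along that direction. By the Weymouth equation it suffices that the
  flow be nonnegative there. This is enforced by the convexified problem, since the chord
  is nonnegative between the two end points of the curve and bounds the flow from below.\<close>

section \<open>The chord of a one-sided Weymouth curve\<close>

lemma affine_between_end_points:
  fixes a b lo hi d :: real
  assumes "lo \<le> d" "d \<le> hi"
  obtains u where "0 \<le> u" "u \<le> 1" "d = (1 - u) * lo + u * hi"
    "a * d + b = (1 - u) * (a * lo + b) + u * (a * hi + b)"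
proof (cases "lo = hi")
  case True
  with assms have "d = (1 - 0) * lo + 0 * hi" by simp
  with True that[of 0] assms show thesis by simp
next
  case False
  define u where "u = (d - lo) / (hi - lo)"
  have u: "0 \<le> u" "u \<le> 1" using assms False by (auto simp: u_def divide_simps)
  have "u * (hi - lo) = d - lo" using False by (simp add: u_def)
  then have d: "d = (1 - u) * lo + u * hi" by (simp add: algebra_simps)
  have "a * d + b = (1 - u) * (a * lo + b) + u * (a * hi + b)"
    unfolding d by (simp add: algebra_simps)
  with u d that show thesis by blast
qed

lemma chord_nonneg:
  fixes a b lo hi d :: real
  assumes "lo \<le> d" "d \<le> hi" "0 \<le> a * lo + b" "0 \<le> a * hi + b"
  shows "0 \<le> a * d + b"
proof -
  obtain u where "0 \<le> u" "u \<le> 1"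
    "a * d + b = (1 - u) * (a * lo + b) + u * (a * hi + b)"
    using affine_between_end_points[OF assms(1,2)] by metis
  then show ?thesis using assms(3,4) by simp
qed

text \<open>Concavity of the square root, in the form in which it is met here: the square of a convex
  combination is at most the convex combination of the squares.\<close>

lemma chord_below_sqrt:
  fixes a b lo hi d W :: real
  assumes "0 \<le> lo" "lo \<le> d" "d \<le> hi" "0 \<le> W"
    and lo: "a * lo + b = sqrt (W * lo)" and hi: "a * hi + b = sqrt (W * hi)"
  shows "a * d + b \<le> sqrt (W * d)"
proof (rule real_le_rsqrt)
  obtain u where u: "0 \<le> u" "u \<le> 1" and d: "d = (1 - u) * lo + u * hi"
    and comb: "a * d + b = (1 - u) * (a * lo + b) + u * (a * hi + b)"
    using affine_between_end_points[OF assms(2,3)] by metis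
  let ?s = "a * lo + b" and ?t = "a * hi + b"
  have sq: "?s\<^sup>2 = W * lo" "?t\<^sup>2 = W * hi"
    unfolding lo hi using assms by auto
  have "0 \<le> u * (1 - u) * (?s - ?t)\<^sup>2" using u by simp
  also have "\<dots> = (1 - u) * ?s\<^sup>2 + u * ?t\<^sup>2 - ((1 - u) * ?s + u * ?t)\<^sup>2"
    by (simp add: power2_eq_square algebra_simps)
  finally have "(a * d + b)\<^sup>2 \<le> (1 - u) * ?s\<^sup>2 + u * ?t\<^sup>2"
    unfolding comb by simp
  also have "\<dots> = W * d" unfolding sq d by (simp add: algebra_simps)
  finally show "(a * d + b)\<^sup>2 \<le> W * d" .
qed

lemma signed_square_eq_iff_sqrt:
  assumes "0 \<le> c"
  shows "q\<^sup>2 * flow_sgn q = c \<longleftrightarrow> q = sqrt c"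
proof
  assume eq: "q\<^sup>2 * flow_sgn q = c"
  have "0 \<le> q"
  proof (rule ccontr)
    assume "\<not> 0 \<le> q"
    then have "- (q\<^sup>2) = c" "0 < q\<^sup>2" using eq by (auto simp: flow_sgn_def)
    then show False using assms by linarith
  qed
  then show "q = sqrt c" using eq by (auto simp: flow_sgn_def)
qed (use assms in \<open>simp add: flow_sgn_def\<close>)

lemma mem_one_sided_curve:
  assumes "0 < weym G l" "pressure_limits G \<pi> {pipe_from G l, pipe_to G l}"
    and "0 \<le> \<pi> (pipe_from G l) - \<pi> (pipe_to G l)"
  shows "(\<pi> (pipe_from G l) - \<pi> (pipe_to G l),
      sqrt (weym G l * (\<pi> (pipe_from G l) - \<pi> (pipe_to G l)))) \<in> weymouth_curve G l"
proof -
  let ?d = "\<pi> (pipe_from G l) - \<pi> (pipe_to G l)"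
  have "weymouth G l \<pi> (sqrt (weym G l * ?d))"
    using assms by (simp add: weymouth_def weymouth_eq_def flow_sgn_def)
  then show ?thesis using assms(2) unfolding weymouth_curve_def by blast
qed

lemma one_sided_drop_nonneg:
  assumes "one_sided G l" "weymouth G l \<pi> q"
    and "pressure_limits G \<pi> {pipe_from G l, pipe_to G l}"
  shows "0 \<le> \<pi> (pipe_from G l) - \<pi> (pipe_to G l)"
  using assms unfolding one_sided_def weymouth_def pressure_limits_def by auto

text \<open>The chord is known only through the end points of the curve, so these have to be exhibited.
  The smallest nonnegative pressure drop is \<open>max 0 (min\<^sub>i - max\<^sub>j)\<close> and the
  largest is \<open>max\<^sub>i - min\<^sub>j\<close>. A pipeline that starts and ends at the same node
  needs separate treatment, because there the two pressures cannot be chosen independently.\<close>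

lemma one_sided_curve_end_points:
  fixes G :: "'a gas_block" and \<pi> :: "'a \<Rightarrow> real"
  defines "d \<equiv> \<lambda>l. \<pi> (pipe_from G l) - \<pi> (pipe_to G l)"
  assumes os: "one_sided G l" and W: "0 < weym G l"
    and lim: "pressure_limits G \<pi> {pipe_from G l, pipe_to G l}" and pos: "0 \<le> d l"
  obtains lo hi where "0 \<le> lo" "lo \<le> d l" "d l \<le> hi"
    "(lo, sqrt (weym G l * lo)) \<in> curve_end_points G l"
    "(hi, sqrt (weym G l * hi)) \<in> curve_end_points G l"
proof (cases "pipe_from G l = pipe_to G l")
  case True
  have z: "fst z = 0" if "z \<in> weymouth_curve G l" for z
    using that True by (auto simp: weymouth_curve_def)
  have "(d l, sqrt (weym G l * d l)) \<in> curve_end_points G l"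
    using mem_one_sided_curve[OF W lim] pos z True
    unfolding curve_end_points_def d_def by auto
  then show thesis using that[of "d l" "d l"] pos by simp
next
  case False
  let ?i = "pipe_from G l" and ?j = "pipe_to G l"
  define hi where "hi = press_max G ?i - press_min G ?j"
  define lo where "lo = max 0 (press_min G ?i - press_max G ?j)"
  have b: "press_min G ?i \<le> \<pi> ?i" "\<pi> ?i \<le> press_max G ?i"
    "press_min G ?j \<le> \<pi> ?j" "\<pi> ?j \<le> press_max G ?j"
    using lim by (auto simp: pressure_limits_def)
  have dhi: "d l \<le> hi" and dlo: "lo \<le> d l"
    using b pos by (auto simp: d_def hi_def lo_def)
  have drop_attained: "(e, sqrt (weym G l * e)) \<in> weymouth_curve G l"
    if e: "0 \<le> e" "e = s - t" "press_min G ?i \<le> s" "s \<le> press_max G ?i"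
      "press_min G ?j \<le> t" "t \<le> press_max G ?j" for e s t
  proof -
    define \<rho> where "\<rho> = (\<lambda>k. if k = ?i then s else t)"
    have "pressure_limits G \<rho> {?i, ?j}" "\<rho> ?i - \<rho> ?j = e"
      using e False by (auto simp: \<rho>_def pressure_limits_def)
    then show ?thesis using mem_one_sided_curve[OF W, of \<rho>] e(1) by auto
  qed
  have hi_mem: "(hi, sqrt (weym G l * hi)) \<in> weymouth_curve G l"
    using drop_attained[of hi "press_max G ?i" "press_min G ?j"] b pos dhi
    by (auto simp: hi_def)
  have lo_mem: "(lo, sqrt (weym G l * lo)) \<in> weymouth_curve G l"
  proof (cases "press_min G ?i \<ge> press_max G ?j")
    case True
    then show ?thesis
      using drop_attained[of lo "press_min G ?i" "press_max G ?j"] b by (auto simp: lo_def)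
  next
    case False
    \<comment> \<open>The two pressure ranges overlap, because the drop \<open>d l\<close> is nonnegative; any
        common value realizes the drop zero.\<close>
    let ?m = "max (press_min G ?i) (press_min G ?j)"
    from False show ?thesis
      using drop_attained[of lo ?m ?m] b pos by (auto simp: lo_def d_def)
  qed
  have range: "lo \<le> fst z \<and> fst z \<le> hi" if curve: "z \<in> weymouth_curve G l" for z
  proof -
    obtain \<rho> q where z: "z = (\<rho> ?i - \<rho> ?j, q)" and w: "weymouth G l \<rho> q"
      and r: "pressure_limits G \<rho> {?i, ?j}"
      using curve unfolding weymouth_curve_def by blast
    show ?thesis using one_sided_drop_nonneg[OF os w r] r
      by (auto simp: z lo_def hi_def pressure_limits_def)
  qed
  show thesis
    using that[of lo hi] dlo dhi hi_mem lo_mem range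
    unfolding curve_end_points_def by (auto simp: lo_def)
qed

text \<open>The upper bound makes the one-sided region a relaxation of the curve; the lower bound
  makes the flows in that region nonnegative. If both end points coincide, the drop \<open>d l\<close> equals theirs, so the line
  need not be determined away from it.\<close>

lemma one_sided_chord_bounds:
  fixes G :: "'a gas_block" and \<pi> :: "'a \<Rightarrow> real"
  defines "d \<equiv> \<lambda>l. \<pi> (pipe_from G l) - \<pi> (pipe_to G l)"
  assumes valid: "valid_ech G E" and l: "l \<in> pipes G" and os: "one_sided G l"
    and W: "0 < weym G l"
    and lim: "pressure_limits G \<pi> {pipe_from G l, pipe_to G l}" and pos: "0 \<le> d l"
  shows "0 \<le> slopeU E l * d l + interU E l"
    and "slopeU E l * d l + interU E l \<le> sqrt (weym G l * d l)"
proof -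
  obtain lo hi where b: "0 \<le> lo" "lo \<le> d l" "d l \<le> hi"
    and mem: "(lo, sqrt (weym G l * lo)) \<in> curve_end_points G l"
      "(hi, sqrt (weym G l * hi)) \<in> curve_end_points G l"
    using one_sided_curve_end_points[OF os W lim] pos unfolding d_def by metis
  have line: "slopeU E l * lo + interU E l = sqrt (weym G l * lo)"
    "slopeU E l * hi + interU E l = sqrt (weym G l * hi)"
    using valid l os mem unfolding valid_ech_def by fastforce+
  show "0 \<le> slopeU E l * d l + interU E l"
    using chord_nonneg[OF b(2,3)] line b W by simp
  show "slopeU E l * d l + interU E l \<le> sqrt (weym G l * d l)"
    using chord_below_sqrt[OF b] line W by simp
qed

section \<open>The convexified problem as a relaxation\<close>

lemma weymouth_curve_subset_ech:
  assumes valid: "valid_ech G E" and l: "l \<in> pipes G" and W: "0 < weym G l"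
  shows "weymouth_curve G l \<subseteq> ech G E l"
proof (cases "one_sided G l")
  case False
  then show ?thesis using valid l unfolding valid_ech_def by auto
next
  case True
  show ?thesis
  proof
    fix z assume "z \<in> weymouth_curve G l"
    then obtain \<pi> q where z: "z = (\<pi> (pipe_from G l) - \<pi> (pipe_to G l), q)"
      and w: "weymouth G l \<pi> q" and lim: "pressure_limits G \<pi> {pipe_from G l, pipe_to G l}"
      unfolding weymouth_curve_def by blast
    let ?d = "\<pi> (pipe_from G l) - \<pi> (pipe_to G l)"
    have pos: "0 \<le> ?d" by (rule one_sided_drop_nonneg[OF True w lim])
    have q: "q = sqrt (weym G l * ?d)"
      using w W pos signed_square_eq_iff_sqrt[of "weym G l * ?d" q]
      by (simp add: weymouth_def weymouth_eq_def)
    have "slopeU E l * ?d + interU E l \<le> q"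
      using one_sided_chord_bounds(2)[OF valid l True W lim pos] by (simp add: q)
    moreover have "q\<^sup>2 \<le> weym G l * ?d" using W pos by (simp add: q)
    ultimately show "z \<in> ech G E l" using True by (simp add: z ech_def)
  qed
qed

lemma pipe_pressure_limits:
  assumes "wf_gas_block S" "l \<in> pipes (gblock S)"
    and "pressure_limits (gblock S) \<pi> (gnodes (gblock S))"
  shows "pressure_limits (gblock S) \<pi> {pipe_from (gblock S) l, pipe_to (gblock S) l}"
  using assms by (simp add: wf_gas_block_def pressure_limits_def Let_def image_subset_iff)

lemma weym_pos:
  assumes "wf_gas_block S" "l \<in> pipes (gblock S)"
  shows "0 < weym (gblock S) l"
  using assms by (simp add: wf_gas_block_def Let_def)

lemma original_subset_convexified:
  assumes wf: "wf_gas_block S" and valid: "valid_ech (gblock S) E"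
  shows "original_feasible S \<subseteq> convexified_feasible S E"
proof
  fix z assume z: "z \<in> original_feasible S"
  let ?G = "gblock S"
  have common: "common_constraints S z" using z by (simp add: original_feasible_def)
  then have lim: "pressure_limits ?G (pressure z) (gnodes ?G)"
    by (simp add: common_constraints_def)
  have "(pressure z (pipe_from ?G l) - pressure z (pipe_to ?G l), pipe_flow z l) \<in> ech ?G E l"
    if l: "l \<in> pipes ?G" for l
  proof -
    have "weymouth ?G l (pressure z) (pipe_flow z l)"
      using z l by (simp add: original_feasible_def)
    then have "(pressure z (pipe_from ?G l) - pressure z (pipe_to ?G l), pipe_flow z l)
        \<in> weymouth_curve ?G l"
      using pipe_pressure_limits[OF wf l lim] unfolding weymouth_curve_def by blast
    then show ?thesis using weymouth_curve_subset_ech[OF valid l weym_pos[OF wf l]] by blast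
  qed
  then show "z \<in> convexified_feasible S E"
    using common by (simp add: convexified_feasible_def)
qed

lemma convexified_one_sided_flow_nonneg:
  assumes wf: "wf_gas_block S" and valid: "valid_ech (gblock S) E"
    and x: "x \<in> convexified_feasible S E"
    and l: "l \<in> pipes (gblock S)" and os: "one_sided (gblock S) l"
  shows "0 \<le> pipe_flow x l"
proof -
  let ?G = "gblock S" and ?q = "pipe_flow x l"
  let ?d = "pressure x (pipe_from ?G l) - pressure x (pipe_to ?G l)"
  have W: "0 < weym ?G l" by (rule weym_pos[OF wf l])
  have lim: "pressure_limits ?G (pressure x) {pipe_from ?G l, pipe_to ?G l}"
    using x pipe_pressure_limits[OF wf l]
    by (simp add: convexified_feasible_def common_constraints_def)
  have "(?d, ?q) \<in> ech ?G E l" using x l by (simp add: convexified_feasible_def)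
  then have chord: "slopeU E l * ?d + interU E l \<le> ?q" and sq: "?q\<^sup>2 \<le> weym ?G l * ?d"
    using os by (auto simp: ech_def)
  have "0 \<le> weym ?G l * ?d" by (rule order_trans[OF zero_le_power2 sq])
  then have "0 \<le> ?d" using W by (simp add: zero_le_mult_iff)
  from one_sided_chord_bounds(1)[OF valid l os W lim this] chord show ?thesis by simp
qed

section \<open>Recovered pressures\<close>

text \<open>Bolzano-Weierstrass for finitely many coordinates. The labels have no topology and may
  come from an infinite type, so this is proved by successive thinning rather than
  in a Euclidean space.\<close>

lemma convergent_subsequence_finitely_many_coordinates:
  fixes f :: "nat \<Rightarrow> 'a \<Rightarrow> real"
  assumes "finite I" "\<And>i. i \<in> I \<Longrightarrow> bounded (range (\<lambda>n. f n i))"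
  obtains r :: "nat \<Rightarrow> nat" where "strict_mono r" "\<And>i. i \<in> I \<Longrightarrow> convergent (\<lambda>n. f (r n) i)"
proof -
  have "\<exists>r :: nat \<Rightarrow> nat. strict_mono r \<and> (\<forall>i\<in>I. convergent (\<lambda>n. f (r n) i))"
    using assms
  proof (induction I rule: finite_induct)
    case empty
    show ?case using strict_mono_id by blast
  next
    case (insert k I)
    then obtain r :: "nat \<Rightarrow> nat" where r: "strict_mono r"
      and conv: "\<forall>i\<in>I. convergent (\<lambda>n. f (r n) i)" by blast
    have "bounded (range (\<lambda>n. f (r n) k))"
      using insert.prems[of k] by (rule bounded_subset) auto
    then obtain c s where s: "strict_mono s" and c: "((\<lambda>n. f (r n) k) \<circ> s) \<longlonglongrightarrow> c"
      using bounded_imp_convergent_subsequence by blast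
    have "convergent (\<lambda>n. f (r (s n)) i)" if "i \<in> insert k I" for i
    proof (cases "i = k")
      case True
      then show ?thesis using c by (auto simp: convergent_def o_def)
    next
      case False
      then show ?thesis
        using conv that convergent_subseq_convergent[OF _ s, of "\<lambda>n. f (r n) i"]
        by (auto simp: o_def)
    qed
    then have "strict_mono (r \<circ> s) \<and> (\<forall>i\<in>insert k I. convergent (\<lambda>n. f ((r \<circ> s) n) i))"
      using strict_mono_o[OF r s] by simp
    then show ?case by blast
  qed
  then show thesis using that by blast
qed

lemma deltas_le_recovery_cost:
  assumes "finite (gnodes G)" "y \<in> recovery_feasible G q" "i \<in> gnodes G"
  shows "delta_plus y i \<le> recovery_cost G y" "delta_minus y i \<le> recovery_cost G y"
proof -
  have nn: "\<forall>j\<in>gnodes G. 0 \<le> delta_plus y j \<and> 0 \<le> delta_minus y j"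
    using assms(2) by (simp add: recovery_feasible_def)
  have "delta_plus y i \<le> sum (delta_plus y) (gnodes G)"
    "delta_minus y i \<le> sum (delta_minus y) (gnodes G)"
    using nn assms(1,3) by (auto intro!: member_le_sum)
  moreover have "0 \<le> sum (delta_plus y) (gnodes G)" "0 \<le> sum (delta_minus y) (gnodes G)"
    using nn by (auto intro!: sum_nonneg)
  ultimately show "delta_plus y i \<le> recovery_cost G y" "delta_minus y i \<le> recovery_cost G y"
    unfolding recovery_cost_def by linarith+
qed

text \<open>Along a minimizing sequence the slacks tend to zero, so the pressures stay bounded at each
  node and a subsequence converges. All constraints are closed, and at vanishing slack the
  relaxed pressure limits become the exact ones.\<close>

lemma recovery_value_zero_attained:
  assumes fin: "finite (gnodes G)"
    and pipe_ends: "pipe_from G ` pipes G \<subseteq> gnodes G" "pipe_to G ` pipes G \<subseteq> gnodes G"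
    and comp_ends: "comp_from G ` compressors G \<subseteq> gnodes G"
      "comp_to G ` compressors G \<subseteq> gnodes G"
    and val: "optimal_value (recovery_feasible G q) (recovery_cost G) = 0"
  obtains \<pi> where "\<forall>l\<in>pipes G. weymouth_eq G l \<pi> (q l)"
    "pressure_limits G \<pi> (gnodes G)" "compression G \<pi>"
proof -
  have "\<exists>y\<in>recovery_feasible G q. recovery_cost G y < 1 / real (Suc n)" for n
  proof -
    have "optimal_value (recovery_feasible G q) (recovery_cost G) < ereal (1 / real (Suc n))"
      using val by simp
    then show ?thesis unfolding optimal_value_def INF_less_iff by simp
  qed
  then obtain y where y: "\<And>n. y n \<in> recovery_feasible G q"
    and cost: "\<And>n. recovery_cost G (y n) < 1 / real (Suc n)" by metis
  define f where "f n = rec_pressure (y n)" for n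
  have weq: "weymouth_eq G l (f n) (q l)" if "l \<in> pipes G" for n l
    using y that by (auto simp: recovery_feasible_def f_def)
  have comp: "f n (comp_to G c) \<le> ratio G c * f n (comp_from G c)"
    if "c \<in> compressors G" for n c
    using y that by (auto simp: recovery_feasible_def compression_def f_def)
  have lower: "(1 - delta_minus (y n) i) * press_min G i \<le> f n i"
    and upper: "f n i \<le> (1 + delta_plus (y n) i) * press_max G i"
    and nn: "0 \<le> delta_plus (y n) i" "0 \<le> delta_minus (y n) i" if "i \<in> gnodes G" for n i
    using y that by (auto simp: recovery_feasible_def f_def)
  have small: "delta_plus (y n) i \<le> 1 / real (Suc n)" "delta_minus (y n) i \<le> 1 / real (Suc n)"
    if "i \<in> gnodes G" for n i
    using deltas_le_recovery_cost[OF fin y that, of n] cost[of n] by linarith+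
  have plus0: "(\<lambda>n. delta_plus (y n) i) \<longlonglongrightarrow> 0"
    and minus0: "(\<lambda>n. delta_minus (y n) i) \<longlonglongrightarrow> 0" if "i \<in> gnodes G" for i
    using nn[OF that] small[OF that]
    by (intro tendsto_sandwich[OF _ _ tendsto_const LIMSEQ_inverse_real_of_nat] always_eventually
        allI; simp add: inverse_eq_divide)+
  have lower_lim: "(\<lambda>n. (1 - delta_minus (y n) i) * press_min G i) \<longlonglongrightarrow> press_min G i"
    and upper_lim: "(\<lambda>n. (1 + delta_plus (y n) i) * press_max G i) \<longlonglongrightarrow> press_max G i"
    if i: "i \<in> gnodes G" for i
    using tendsto_mult_right[OF tendsto_diff[OF tendsto_const minus0[OF i]], of 1]
      tendsto_mult_right[OF tendsto_add[OF tendsto_const plus0[OF i]], of 1] by simp_all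
  have "bounded (range (\<lambda>n. f n i))" if i: "i \<in> gnodes G" for i
  proof -
    have "Bseq (\<lambda>n. (1 - delta_minus (y n) i) * press_min G i)"
      "Bseq (\<lambda>n. (1 + delta_plus (y n) i) * press_max G i)"
      using lower_lim[OF i] upper_lim[OF i] by (auto intro!: convergent_imp_Bseq convergentI)
    then obtain K L where
      K: "\<And>n. \<bar>(1 - delta_minus (y n) i) * press_min G i\<bar> \<le> K" and
      L: "\<And>n. \<bar>(1 + delta_plus (y n) i) * press_max G i\<bar> \<le> L"
      unfolding Bseq_def real_norm_def by blast
    have "norm (f n i) \<le> max K L" for n
      using K[of n] L[of n] lower[OF i, of n] upper[OF i, of n] unfolding real_norm_def by linarith
    then show ?thesis by (auto intro!: boundedI)
  qed
  then obtain r :: "nat \<Rightarrow> nat" where r: "strict_mono r"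
    and conv: "\<And>i. i \<in> gnodes G \<Longrightarrow> convergent (\<lambda>n. f (r n) i)"
    using convergent_subsequence_finitely_many_coordinates[OF fin, of f] by blast
  define \<pi> where "\<pi> i = lim (\<lambda>n. f (r n) i)" for i
  have lim: "(\<lambda>n. f (r n) i) \<longlonglongrightarrow> \<pi> i" if "i \<in> gnodes G" for i
    using conv[OF that] by (simp add: \<pi>_def convergent_LIMSEQ_iff)
  show thesis
  proof
    show "\<forall>l\<in>pipes G. weymouth_eq G l \<pi> (q l)"
    proof
      fix l assume l: "l \<in> pipes G"
      have "(\<lambda>n. weym G l * (f (r n) (pipe_from G l) - f (r n) (pipe_to G l)))
          \<longlonglongrightarrow> weym G l * (\<pi> (pipe_from G l) - \<pi> (pipe_to G l))"
        using pipe_ends l by (intro tendsto_intros lim) auto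
      moreover have "weym G l * (f (r n) (pipe_from G l) - f (r n) (pipe_to G l))
          = (q l)\<^sup>2 * flow_sgn (q l)" for n
        using weq[OF l] by (simp add: weymouth_eq_def)
      ultimately show "weymouth_eq G l \<pi> (q l)"
        by (simp add: weymouth_eq_def LIMSEQ_const_iff)
    qed
    show "compression G \<pi>"
      unfolding compression_def
    proof
      fix c assume c: "c \<in> compressors G"
      then have ends: "comp_from G c \<in> gnodes G" "comp_to G c \<in> gnodes G"
        using comp_ends by auto
      show "\<pi> (comp_to G c) \<le> ratio G c * \<pi> (comp_from G c)"
        by (rule LIMSEQ_le[OF lim[OF ends(2)] tendsto_mult_left[OF lim[OF ends(1)]]])
          (use comp[OF c] in blast)
    qed
    show "pressure_limits G \<pi> (gnodes G)"
      unfolding pressure_limits_def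
    proof
      fix i assume i: "i \<in> gnodes G"
      have "(\<lambda>n. (1 - delta_minus (y (r n)) i) * press_min G i) \<longlonglongrightarrow> press_min G i"
        "(\<lambda>n. (1 + delta_plus (y (r n)) i) * press_max G i) \<longlonglongrightarrow> press_max G i"
        using LIMSEQ_subseq_LIMSEQ[OF lower_lim[OF i] r] LIMSEQ_subseq_LIMSEQ[OF upper_lim[OF i] r]
        by (simp_all add: o_def)
      from LIMSEQ_le[OF this(1) lim[OF i]] LIMSEQ_le[OF lim[OF i] this(2)]
      show "press_min G i \<le> \<pi> i \<and> \<pi> i \<le> press_max G i"
        using lower[OF i] upper[OF i] by auto
    qed
  qed
qed

lemma replace_pressure_original_feasible:
  assumes wf: "wf_gas_block S" and valid: "valid_ech (gblock S) E"
    and x: "x \<in> convexified_feasible S E"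
    and weq: "\<forall>l\<in>pipes (gblock S). weymouth_eq (gblock S) l \<pi> (pipe_flow x l)"
    and lim: "pressure_limits (gblock S) \<pi> (gnodes (gblock S))"
    and comp: "compression (gblock S) \<pi>"
  shows "x\<lparr>pressure := \<pi>\<rparr> \<in> original_feasible S"
proof -
  let ?G = "gblock S"
  have "common_constraints S x" using x by (simp add: convexified_feasible_def)
  then have "common_constraints S (x\<lparr>pressure := \<pi>\<rparr>)"
    using lim comp
    by (simp add: common_constraints_def power_limits_def power_flow_eqs_def power_balance_def
        gas_limits_def gas_balance_def coupling_def)
  moreover have "weymouth ?G l \<pi> (pipe_flow x l)" if l: "l \<in> pipes ?G" for l
  proof -
    have "\<pi> (pipe_to ?G l) \<le> \<pi> (pipe_from ?G l)" if "l \<in> fixed_pipes ?G"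
    proof -
      have "one_sided ?G l" using that by (simp add: one_sided_def)
      then have "0 \<le> pipe_flow x l"
        by (rule convexified_one_sided_flow_nonneg[OF wf valid x l])
      then have "0 \<le> (pipe_flow x l)\<^sup>2 * flow_sgn (pipe_flow x l)" by (simp add: flow_sgn_def)
      then have "0 \<le> weym ?G l * (\<pi> (pipe_from ?G l) - \<pi> (pipe_to ?G l))"
        using weq l by (simp add: weymouth_eq_def)
      then show ?thesis using weym_pos[OF wf l] by (simp add: zero_le_mult_iff)
    qed
    then show ?thesis using weq l by (simp add: weymouth_def)
  qed
  ultimately show ?thesis by (simp add: original_feasible_def)
qed

section \<open>Equality of the optimal values\<close>

theorem proposition1:
  fixes S :: "'a energy_system" and E :: "'a ech_consts" and x :: "'a flow_point"
  assumes "wf_system S"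
    and "valid_ech (gblock S) E"
    and "original_feasible S \<noteq> {}"
    and "is_arg_min (oef_cost S) (\<lambda>z. z \<in> convexified_feasible S E) x"
    and "recovery_feasible (gblock S) (pipe_flow x) \<noteq> {}"
    and "optimal_value (recovery_feasible (gblock S) (pipe_flow x)) (recovery_cost (gblock S)) = 0"
  shows "optimal_value (original_feasible S) (oef_cost S)
       = optimal_value (convexified_feasible S E) (oef_cost S)"
proof (rule antisym)
  let ?G = "gblock S"
  have wf: "wf_gas_block S" using assms(1) by (simp add: wf_system_def)
  have x: "x \<in> convexified_feasible S E"
    and min: "\<And>z. z \<in> convexified_feasible S E \<Longrightarrow> oef_cost S x \<le> oef_cost S z"
    using assms(4) by (auto simp: is_arg_min_linorder)
  have "finite (gnodes ?G)" "pipe_from ?G ` pipes ?G \<subseteq> gnodes ?G"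
    "pipe_to ?G ` pipes ?G \<subseteq> gnodes ?G" "comp_from ?G ` compressors ?G \<subseteq> gnodes ?G"
    "comp_to ?G ` compressors ?G \<subseteq> gnodes ?G"
    using wf by (auto simp: wf_gas_block_def Let_def)
  then obtain \<pi> where "\<forall>l\<in>pipes ?G. weymouth_eq ?G l \<pi> (pipe_flow x l)"
    "pressure_limits ?G \<pi> (gnodes ?G)" "compression ?G \<pi>"
    using assms(6) by (rule recovery_value_zero_attained)
  then have "x\<lparr>pressure := \<pi>\<rparr> \<in> original_feasible S"
    by (rule replace_pressure_original_feasible[OF wf assms(2) x])
  moreover have "oef_cost S (x\<lparr>pressure := \<pi>\<rparr>) = oef_cost S x" by (simp add: oef_cost_def)
  ultimately have "optimal_value (original_feasible S) (oef_cost S) \<le> ereal (oef_cost S x)"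
    unfolding optimal_value_def by (metis INF_lower)
  also have "\<dots> \<le> optimal_value (convexified_feasible S E) (oef_cost S)"
    unfolding optimal_value_def by (rule INF_greatest) (simp add: min)
  finally show "optimal_value (original_feasible S) (oef_cost S)
      \<le> optimal_value (convexified_feasible S E) (oef_cost S)" .
  show "optimal_value (convexified_feasible S E) (oef_cost S)
      \<le> optimal_value (original_feasible S) (oef_cost S)"
    unfolding optimal_value_def
    by (rule INF_superset_mono[OF original_subset_convexified[OF wf assms(2)]]) simp
qed

end
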